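(* Let $\mathcal{PM}\subset\mathbb{R}$ be the Perez-Marco set. For every $\sigma>2$, the complement $\mathbb{R}\setminus\mathcal{PM}$ has zero $C^2_\sigma$-capacity, i.e. $C^2_\sigma(\mathbb{R}\setminus\mathcal{PM})=0$, where $C^2_\sigma$ is the capacity associated with the kernel $$k^2_\sigma(z,\xi)=\ln^{2}\ln\left(e+\frac{1}{|z-\xi|}\right)\cdot\ln^{\sigma}\ln\ln\left(e^3+\frac{1}{|z-\xi|}\right).$$ In particular, for every $\sigma>2$, $\mathbb{R}\setminus\mathcal{PM}$ has zero Hausdorff $H^{h^2_\sigma}$-measure with respect to the gauge function $$h^2_\sigma(t)=\ln^{-2}\ln\frac1t\cdot\ln^{-\sigma}\ln\ln\frac1t,\qquad 0\le t\le e^{-10}$$ (with $h^2_\sigma(0)=0$).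
   Context: **Continued fractions.** For irrational $\alpha\in\mathbb{R}$ put $a_0=[\alpha]$ (integer part), $\alpha_0=\alpha-[\alpha]$, and inductively $a_{n+1}=[1/\alpha_n]$, $\alpha_{n+1}=1/\alpha_n-[1/\alpha_n]$. Then $\alpha=[a_0,a_1,a_2,\dots]=a_0+\cfrac{1}{a_1+\cfrac{1}{a_2+\cdots}}$ with $a_j\ge 1$ integers for $j\ge1$. The $n$-th convergent is $P_n/Q_n=[a_0,a_1,\dots,a_n]$, in lowest terms with $Q_n\ge1$. **Perez-Marco set.** An irrational $\alpha\in\mathbb{R}$ is a Perez-Marco number if $\sum_{n=1}^\infty \frac{\ln\ln Q_{n+1}}{Q_n}<+\infty$. $\mathcal{PM}$ is the set of all Perez-Marco numbers. **Notation.** $\ln^a\ln x$ means $(\ln\ln x)^a$, $\ln^a\ln\ln x$ means $(\ln\ln\ln x)^a$. **Capacity.** The kernel $k=k^2_\sigma$ on $\mathbb{C}\times\mathbb{C}$ takes the value $+\infty$ on the diagonal $z=\xi$. For a compact set $K\subset\mathbb{C}$ let $W(K)=\inf_\mu \iint_{K\times K}k(z,\xi)\,d\mu(z)\,d\mu(\xi)$, the infimum being over Borel probability measures $\mu$ supported on $K$, and $C(K)=W(K)^{-1}$ (with $1/(+\infty)=0$). For a Borel set $E\subset\mathbb{C}$ the inner capacity is $\underline{C}(E)=\sup\{C(K):K\subset E,\ K\text{ compact}\}$ and the outer capacity is $\overline{C}(E)=\inf\{C(U):U\supset E,\ U\text{ open}\}$, where for open $U$ one sets $C(U)=\underline C(U)$.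 For Borel sets the two coincide, and the common value is denoted $C(E)$; for this kernel it is written $C^2_\sigma(E)$. Here $\mathbb{R}\subset\mathbb{C}$. **Hausdorff $H^h$-measure (as defined by the authors).** Let $E\subset\mathbb{R}^n$ be a bounded set and let $h:[0,r_0]\to[0,+\infty)$, $r_0>0$, be a strictly increasing continuous function with $h(0)=0$. For fixed $\varepsilon>0$, consider coverings of $E$ by finite families of open balls $B_j(x_j,r_j)$, $1\le j\le m$, with $r_j<\varepsilon$, and put $$H^h(E,\varepsilon)=\inf\Big\{\sum_{j=1}^m h(r_j):\ \bigcup_{j=1}^m B_j\supset E\Big\},\qquad H^h(E)=\lim_{\varepsilon\to0+}H^h(E,\varepsilon).$$ The limit $H^h(E)$ is called the Hausdorff $H^h$-measure of $E$. The authors add that for $h_\alpha(t)=t^\alpha$, $\alpha>0$, the measure $H^{h_\alpha}(E)$ becomes the standard $\alpha$-dimensional Hausdorff measure $H^\alpha(E)$.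
   Formalization: The Hausdorff measure is taken with countable families of balls and for arbitrary, not only bounded, sets; with finite families the set, which is unbounded and contains the rationals, would have infinite measure and the claim would be false. *)

theory Defs
  imports "HOL-Probability.Probability"
begin

primrec cf_rem :: "real \<Rightarrow> nat \<Rightarrow> real" where
  "cf_rem \<alpha> 0 = \<alpha> - of_int \<lfloor>\<alpha>\<rfloor>"
| "cf_rem \<alpha> (Suc n) = 1 / cf_rem \<alpha> n - of_int \<lfloor>1 / cf_rem \<alpha> n\<rfloor>"

primrec cf_coeff :: "real \<Rightarrow> nat \<Rightarrow> int" where
  "cf_coeff \<alpha> 0 = \<lfloor>\<alpha>\<rfloor>"
| "cf_coeff \<alpha> (Suc n) = \<lfloor>1 / cf_rem \<alpha> n\<rfloor>"

text \<open>The value of a finite continued fraction; the empty list is never used.\<close>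

fun cf_value :: "int list \<Rightarrow> rat" where
  "cf_value [] = 0"
| "cf_value [a] = of_int a"
| "cf_value (a # b # as) = of_int a + 1 / cf_value (b # as)"

definition cf_convergent :: "real \<Rightarrow> nat \<Rightarrow> rat" where
  "cf_convergent \<alpha> n = cf_value (map (cf_coeff \<alpha>) [0..<Suc n])"

text \<open>\<^const>\<open>quotient_of\<close> returns numerator and denominator in lowest terms, with
  positive denominator.\<close>

definition cf_denom :: "real \<Rightarrow> nat \<Rightarrow> int" where
  "cf_denom \<alpha> n = snd (quotient_of (cf_convergent \<alpha> n))"

text \<open>The series starts at index 1, hence the shift. For irrational \<open>\<alpha>\<close> all terms but the first
  are positive (\<open>Q\<^sub>3 \<ge> 3\<close>), so having a sum below \<open>+\<infinity>\<close> is convergence.\<close>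

definition Perez_Marco :: "real set" where
  "Perez_Marco = {\<alpha>. \<alpha> \<notin> \<rat> \<and>
     summable (\<lambda>n. ln (ln (real_of_int (cf_denom \<alpha> (Suc n + 1)))) /
                   real_of_int (cf_denom \<alpha> (Suc n)))}"

definition energy :: "(complex \<Rightarrow> complex \<Rightarrow> ennreal) \<Rightarrow> complex set \<Rightarrow> complex measure \<Rightarrow> ennreal" where
  "energy k K \<mu> = (\<integral>\<^sup>+p\<in>K \<times> K. k (fst p) (snd p) \<partial>(\<mu> \<Otimes>\<^sub>M \<mu>))"

definition min_energy :: "(complex \<Rightarrow> complex \<Rightarrow> ennreal) \<Rightarrow> complex set \<Rightarrow> ennreal" where
  "min_energy k K =
     (INF \<mu>\<in>{\<mu>. prob_space \<mu> \<and> sets \<mu> = sets borel \<and> emeasure \<mu> (- K) = 0}. energy k K \<mu>)"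

definition compact_capacity :: "(complex \<Rightarrow> complex \<Rightarrow> ennreal) \<Rightarrow> complex set \<Rightarrow> ennreal" where
  "compact_capacity k K = inverse (min_energy k K)"

definition inner_capacity :: "(complex \<Rightarrow> complex \<Rightarrow> ennreal) \<Rightarrow> complex set \<Rightarrow> ennreal" where
  "inner_capacity k E = (SUP K\<in>{K. compact K \<and> K \<subseteq> E}. compact_capacity k K)"

definition outer_capacity :: "(complex \<Rightarrow> complex \<Rightarrow> ennreal) \<Rightarrow> complex set \<Rightarrow> ennreal" where
  "outer_capacity k E = (INF U\<in>{U. open U \<and> E \<subseteq> U}. inner_capacity k U)"

text \<open>The capacity of \<open>E\<close> is the common value of its inner and outer capacities.\<close>

definition has_capacity :: "(complex \<Rightarrow> complex \<Rightarrow> ennreal) \<Rightarrow> complex set \<Rightarrow> ennreal \<Rightarrow> bool" where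
  "has_capacity k E c \<longleftrightarrow> inner_capacity k E = c \<and> outer_capacity k E = c"

definition kernel2 :: "real \<Rightarrow> complex \<Rightarrow> complex \<Rightarrow> ennreal" where
  "kernel2 \<sigma> z \<xi> = (if z = \<xi> then \<infinity> else
     ennreal (ln (ln (exp 1 + 1 / cmod (z - \<xi>))) ^ 2 *
              ln (ln (ln (exp 3 + 1 / cmod (z - \<xi>)))) powr \<sigma>))"

text \<open>The coverings are countable families of open balls, as for the standard Hausdorff measures:
  with finite families only, an unbounded set would have no covering at all, and a set could not be
  distinguished from its closure. Finite families are included by allowing radius 0, since
  \<open>ball x 0 = {}\<close> and a gauge vanishes at 0.\<close>

definition hausdorff_content ::
    "(real \<Rightarrow> real) \<Rightarrow> 'a::euclidean_space set \<Rightarrow> real \<Rightarrow> ennreal" where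
  "hausdorff_content h E \<epsilon> =
     Inf {(\<Sum>j. ennreal (h (r j))) | (x :: nat \<Rightarrow> 'a) (r :: nat \<Rightarrow> real).
            (\<forall>j. 0 \<le> r j \<and> r j < \<epsilon>) \<and> E \<subseteq> (\<Union>j. ball (x j) (r j))}"

text \<open>A gauge only matters near 0; the limit exists because the content increases as
  \<open>\<epsilon>\<close> decreases.\<close>

definition hausdorff_measure :: "(real \<Rightarrow> real) \<Rightarrow> 'a::euclidean_space set \<Rightarrow> ennreal" where
  "hausdorff_measure h E = Lim (at_right 0) (hausdorff_content h E)"

text \<open>The intended domain is \<open>0 \<le> t \<le> exp (- 10)\<close>, where all iterated logarithms below are
  positive.\<close>

definition gauge2 :: "real \<Rightarrow> real \<Rightarrow> real" where
  "gauge2 \<sigma> t = (if t = 0 then 0 else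
     ln (ln (1 / t)) powr (- 2) * ln (ln (ln (1 / t))) powr (- \<sigma>))"

end

theory Submission
  imports Defs "HOL-Real_Asymp.Real_Asymp"
begin

text \<open>
  If \<open>ln ln Q\<^sub>n\<^sub>+\<^sub>1 \<le> Q\<^sub>n / (ln Q\<^sub>n)\<^bsup>1/4\<^esup>\<close> eventually, then \<open>\<alpha>\<close> is a Perez-Marco number: the terms with
  \<open>ln ln Q\<^sub>n\<^sub>+\<^sub>1 \<le> \<surd>Q\<^sub>n\<close> are dominated by a geometric series, and whenever this fails
  \<open>v\<^sub>n = (ln Q\<^sub>n)\<^bsup>-1/4\<^esup>\<close> at least halves, so that these terms are dominated by the telescoping
  \<open>2 (v\<^sub>n - v\<^sub>n\<^sub>+\<^sub>1)\<close>. Hence every point of the complement lies, for infinitely many \<open>q\<close>, in some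
  interval of radius \<open>exp (- exp (q (ln q)\<^bsup>-1/4\<^esup>))\<close> around a fraction \<open>p / q\<close> with
  \<open>\<bar>p\<bar> \<le> q (ln q)\<^bsup>1/4\<^esup>\<close>; this bound on \<open>p\<close> holds as soon as \<open>q\<close> is large in terms of \<open>\<alpha>\<close>, and it
  covers the whole line by one family. For rational \<open>\<alpha>\<close> take \<open>p / q = \<alpha>\<close>, unreduced. The gauge values of these intervals sum to
  \<open>O(\<Sum> 1 / (q (ln q)\<^bsup>\<sigma> - 3/4\<^esup>)) < \<infinity>\<close>, which settles the Hausdorff measure.

  For the capacity, let \<open>\<mu>\<close> be a probability measure on a compact subset of the union of the corresponding
  discs. Cutting it into disjoint pieces \<open>A\<^sub>j\<close>, one per disc, and using that the kernel is at least
  \<open>1 / g\<^sub>j\<close> on the \<open>j\<close>-th disc, the energy of \<open>\<mu>\<close> is at least \<open>\<Sum> \<mu>(A\<^sub>j)\<^sup>2 / g\<^sub>j\<close>, which is at least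
  \<open>1 / \<Sum> g\<^sub>j\<close> by Cauchy-Schwarz, and \<open>g\<^sub>j\<close> is comparable to the gauge of the radius.
\<close>

subsection \<open>Convergents\<close>

text \<open>The classical recurrence for the numerators of the convergents, started at indices 0 and
  1 to avoid index -1. It takes an arbitrary sequence because the inductions below pass to shifted
  sequences.\<close>

fun cf_num_rec :: "(nat \<Rightarrow> int) \<Rightarrow> nat \<Rightarrow> int" where
  "cf_num_rec a 0 = a 0"
| "cf_num_rec a (Suc 0) = a 1 * a 0 + 1"
| "cf_num_rec a (Suc (Suc n)) = a (Suc (Suc n)) * cf_num_rec a (Suc n) + cf_num_rec a n"

fun cf_denom_rec :: "(nat \<Rightarrow> int) \<Rightarrow> nat \<Rightarrow> int" where
  "cf_denom_rec a 0 = 1"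
| "cf_denom_rec a (Suc 0) = a 1"
| "cf_denom_rec a (Suc (Suc n)) = a (Suc (Suc n)) * cf_denom_rec a (Suc n) + cf_denom_rec a n"

text \<open>Both sides satisfy the same recurrence with the same start. Shifts are needed because
  \<open>cf_value\<close> peels off the first entry while the recurrences append at the end.\<close>

lemma cf_denom_rec_shift: "cf_denom_rec a (Suc n) = cf_num_rec (\<lambda>k. a (Suc k)) n"
  by (induction n rule: induct_nat_012) auto

lemma cf_num_rec_shift:
  "cf_num_rec a (Suc n) = a 0 * cf_num_rec (\<lambda>k. a (Suc k)) n + cf_denom_rec (\<lambda>k. a (Suc k)) n"
  by (induction n rule: induct_nat_012) (auto simp: algebra_simps)

lemma cf_denom_rec_pos:
  assumes "\<And>k. a (Suc k) \<ge> 1"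
  shows "cf_denom_rec a n \<ge> 1"
proof (induction n rule: induct_nat_012)
  case (ge2 n)
  then show ?case
    using mult_nonneg_nonneg[of "a (Suc (Suc n))" "cf_denom_rec a (Suc n)"] assms[of "Suc n"]
    unfolding cf_denom_rec.simps by linarith
qed (use assms[of 0] in auto)

lemma cf_num_rec_pos:
  assumes "\<And>k. a k \<ge> 1"
  shows "cf_num_rec a n \<ge> 1"
  \<comment> \<open>Prepending an entry turns numerators into denominators.\<close>
  using cf_denom_rec_pos[of "case_nat 0 a" "Suc n"] assms by (simp add: cf_denom_rec_shift)

text \<open>Induction over all sequences at once, since the tail is the fraction of the shifted
  sequence. Positivity keeps the numerator of the tail away from 0.\<close>

lemma cf_value_eq:
  assumes "\<And>k. a (Suc k) \<ge> 1"
  shows "cf_value (map a [0..<Suc n]) = of_int (cf_num_rec a n) / of_int (cf_denom_rec a n)"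
  using assms
proof (induction n arbitrary: a)
  case (Suc n)
  let ?b = "\<lambda>k. a (Suc k)"
  have b: "map a [0..<Suc (Suc n)] = a 0 # map ?b [0..<Suc n]"
    by (simp only: upt_conv_Cons[of 0 "Suc (Suc n)"] map_Suc_upt[symmetric]) simp
  have "cf_value (a 0 # map ?b [0..<Suc n]) = of_int (a 0) + 1 / cf_value (map ?b [0..<Suc n])"
    by (simp add: upt_conv_Cons del: upt_Suc)
  also have "cf_value (map ?b [0..<Suc n]) = of_int (cf_num_rec ?b n) / of_int (cf_denom_rec ?b n)"
    by (rule Suc.IH) (rule Suc.prems)
  finally show ?case
    using cf_num_rec_pos[of ?b n] Suc.prems
    by (simp only: b cf_num_rec_shift cf_denom_rec_shift) (simp add: field_simps)
qed auto

lemma cf_rec_determinant: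
  "\<bar>cf_num_rec a (Suc n) * cf_denom_rec a n - cf_num_rec a n * cf_denom_rec a (Suc n)\<bar> = 1"
proof (induction n)
  case (Suc n)
  have "cf_num_rec a (Suc (Suc n)) * cf_denom_rec a (Suc n) - cf_num_rec a (Suc n) * cf_denom_rec a (Suc (Suc n))
    = - (cf_num_rec a (Suc n) * cf_denom_rec a n - cf_num_rec a n * cf_denom_rec a (Suc n))"
    by (simp add: algebra_simps)
  then show ?case using Suc by linarith
qed auto

text \<open>A common divisor divides the determinant, which is 1 up to sign.\<close>

lemma coprime_cf_rec: "coprime (cf_num_rec a n) (cf_denom_rec a n)"
proof (rule coprimeI)
  fix c assume "c dvd cf_num_rec a n" "c dvd cf_denom_rec a n"
  then have "c dvd cf_num_rec a (Suc n) * cf_denom_rec a n - cf_num_rec a n * cf_denom_rec a (Suc n)"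
    by simp
  then show "is_unit c"
    using cf_rec_determinant[of a n] by (metis dvd_abs_iff)
qed

section \<open>Remainders and approximation errors of an irrational number\<close>

lemma cf_rem_props:
  fixes \<alpha> :: real
  assumes "\<alpha> \<notin> \<rat>"
  shows "cf_rem \<alpha> n \<notin> \<rat>" "0 < cf_rem \<alpha> n" "cf_rem \<alpha> n < 1"
proof -
  show irr: "cf_rem \<alpha> n \<notin> \<rat>"
  proof (induction n)
    case 0
    then show ?case using assms Rats_add[of "\<alpha> - of_int \<lfloor>\<alpha>\<rfloor>" "of_int \<lfloor>\<alpha>\<rfloor>"] by auto
  next
    case (Suc n)
    then show ?case
      using Rats_add[of "1 / cf_rem \<alpha> n - of_int \<lfloor>1 / cf_rem \<alpha> n\<rfloor>" "of_int \<lfloor>1 / cf_rem \<alpha> n\<rfloor>"]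
        Rats_inverse[of "1 / cf_rem \<alpha> n"] by (auto simp: field_simps)
  qed
  have bounds: "0 \<le> cf_rem \<alpha> n \<and> cf_rem \<alpha> n < 1"
    by (cases n) (auto, linarith+)
  then show "cf_rem \<alpha> n < 1" by blast
  show "0 < cf_rem \<alpha> n"
    using irr bounds by (metis Rats_0 order_less_le)
qed

lemma cf_rem_unfold: "1 / cf_rem \<alpha> n = cf_coeff \<alpha> (Suc n) + cf_rem \<alpha> (Suc n)"
  by simp

lemma cf_coeff_ge_1:
  fixes \<alpha> :: real
  assumes "\<alpha> \<notin> \<rat>"
  shows "cf_coeff \<alpha> (Suc n) \<ge> 1"
  using cf_rem_props[OF assms, of n] by (simp add: le_floor_iff)

declare cf_rem.simps [simp del] cf_coeff.simps [simp del]

text \<open>The recurrence already yields a coprime fraction with positive denominator, so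
  \<open>quotient_of\<close> returns it unchanged.\<close>

lemma cf_denom_eq:
  fixes \<alpha> :: real
  assumes "\<alpha> \<notin> \<rat>"
  shows "cf_denom \<alpha> n = cf_denom_rec (cf_coeff \<alpha>) n"
proof -
  let ?p = "cf_num_rec (cf_coeff \<alpha>) n" and ?q = "cf_denom_rec (cf_coeff \<alpha>) n"
  have "?q \<ge> 1" using cf_coeff_ge_1[OF assms] by (rule cf_denom_rec_pos)
  moreover have "cf_convergent \<alpha> n = Fract ?p ?q"
    unfolding cf_convergent_def using cf_value_eq[of "cf_coeff \<alpha>" n] cf_coeff_ge_1[OF assms]
    by (simp add: Fract_of_int_quotient del: upt_Suc)
  ultimately show ?thesis
    using coprime_cf_rec[of "cf_coeff \<alpha>" n]
    by (simp add: cf_denom_def quotient_of_Fract normalize_stable)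
qed

text \<open>The errors \<open>d\<close> obey the same linear recurrence as numerators and
  denominators; writing \<open>1 / cf_rem \<alpha> (Suc n)\<close> as coefficient plus next
  remainder makes the coefficient cancel.\<close>

lemma cf_error_step:
  fixes \<alpha> :: real and d :: "nat \<Rightarrow> real"
  assumes "\<alpha> \<notin> \<rat>"
  defines "d \<equiv> \<lambda>n. \<alpha> * cf_denom_rec (cf_coeff \<alpha>) n - cf_num_rec (cf_coeff \<alpha>) n"
  shows "d (Suc n) = - d n * cf_rem \<alpha> (Suc n)"
proof (induction n)
  case 0
  have "cf_rem \<alpha> 0 * (cf_coeff \<alpha> 1 + cf_rem \<alpha> 1) = 1"
    using cf_rem_unfold[of \<alpha> 0] cf_rem_props[OF assms(1), of 0]
    by (metis One_nat_def less_irrefl nonzero_eq_divide_eq mult.commute)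
  moreover have "cf_rem \<alpha> 0 = \<alpha> - cf_coeff \<alpha> 0"
    by (simp add: cf_rem.simps cf_coeff.simps)
  ultimately show ?case
    by (simp add: d_def algebra_simps)
next
  case (Suc n)
  let ?r = "cf_rem \<alpha> (Suc n)"
  have "d (Suc (Suc n)) = cf_coeff \<alpha> (Suc (Suc n)) * d (Suc n) + d n"
    by (simp add: d_def algebra_simps)
  moreover have "d n = - d (Suc n) * (1 / ?r)"
    using Suc cf_rem_props[OF assms(1), of "Suc n"] by (simp add: field_simps)
  ultimately show ?case
    unfolding cf_rem_unfold by (simp add: algebra_simps)
qed

text \<open>The determinant identity in terms of errors: consecutive errors alternate in sign, so
  their weighted absolute values add up to 1.\<close>

lemma cf_error_identity:
  fixes \<alpha> :: real and D :: "nat \<Rightarrow> real"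
  assumes "\<alpha> \<notin> \<rat>"
  defines "D \<equiv> \<lambda>n. \<bar>\<alpha> * cf_denom_rec (cf_coeff \<alpha>) n - cf_num_rec (cf_coeff \<alpha>) n\<bar>"
  shows "cf_denom_rec (cf_coeff \<alpha>) (Suc n) * D n + cf_denom_rec (cf_coeff \<alpha>) n * D (Suc n) = 1"
proof (induction n)
  have step: "D (Suc n) = D n * cf_rem \<alpha> (Suc n)" for n
    unfolding D_def cf_error_step[OF assms(1)]
    using cf_rem_props[OF assms(1), of "Suc n"] by (simp add: abs_mult)
  {
    case 0
    have "D 0 = cf_rem \<alpha> 0" using of_int_floor_le[of \<alpha>] by (simp add: D_def cf_rem.simps cf_coeff.simps)
    moreover have "cf_rem \<alpha> 0 * (cf_coeff \<alpha> 1 + cf_rem \<alpha> 1) = 1"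
      using cf_rem_unfold[of \<alpha> 0] cf_rem_props[OF assms(1), of 0]
      by (metis One_nat_def less_irrefl nonzero_eq_divide_eq mult.commute)
    ultimately show ?case
      by (simp add: step algebra_simps)
  next
    case (Suc n)
    have "D n = D (Suc n) * (cf_coeff \<alpha> (Suc (Suc n)) + cf_rem \<alpha> (Suc (Suc n)))"
      unfolding cf_rem_unfold[symmetric]
      using cf_rem_props[OF assms(1), of "Suc n"] step[of n] by simp
    with Suc show ?case
      by (simp add: step[of "Suc n"] algebra_simps)
  }
qed

text \<open>Dropping one summand of \<open>cf_error_identity\<close> bounds the error by the
  reciprocal of the next denominator. The further factor \<open>1 / cf_denom \<alpha> n\<close> is
  given away.\<close>

lemma cf_approximation:
  fixes \<alpha> :: real
  assumes "\<alpha> \<notin> \<rat>"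
  shows "\<exists>p::int. \<bar>\<alpha> - p / cf_denom \<alpha> n\<bar> \<le> 1 / cf_denom \<alpha> (Suc n)"
proof
  let ?p = "cf_num_rec (cf_coeff \<alpha>)" and ?q = "cf_denom_rec (cf_coeff \<alpha>)"
  have pos: "?q k \<ge> 1" for k using cf_coeff_ge_1[OF assms] by (rule cf_denom_rec_pos)
  have "?q (Suc n) * \<bar>\<alpha> * ?q n - ?p n\<bar> \<le> 1"
    using cf_error_identity[OF assms, of n] pos[of n] by (smt (verit) mult_nonneg_nonneg of_int_0_le_iff)
  then have "\<bar>\<alpha> * ?q n - ?p n\<bar> \<le> 1 / ?q (Suc n)"
    using pos[of "Suc n"] by (simp add: field_simps)
  moreover have "\<bar>\<alpha> - ?p n / ?q n\<bar> = \<bar>\<alpha> * ?q n - ?p n\<bar> / ?q n"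
  proof -
    have "\<alpha> - ?p n / ?q n = (\<alpha> * ?q n - ?p n) / ?q n"
      using pos[of n] by (simp add: diff_divide_distrib)
    then show ?thesis using pos[of n] by (simp add: abs_divide)
  qed
  moreover have "\<dots> \<le> \<bar>\<alpha> * ?q n - ?p n\<bar>"
    using pos[of n] by (simp add: divide_le_eq mult_le_cancel_left1)
  ultimately show "\<bar>\<alpha> - ?p n / cf_denom \<alpha> n\<bar> \<le> 1 / cf_denom \<alpha> (Suc n)"
    by (simp add: cf_denom_eq[OF assms])
qed

lemma cf_denom_growth:
  fixes \<alpha> :: real
  assumes "\<alpha> \<notin> \<rat>"
  shows "cf_denom \<alpha> n \<ge> 1" "cf_denom \<alpha> n \<le> cf_denom \<alpha> (Suc n)"
    "real_of_int (cf_denom \<alpha> n) \<ge> 2/3 * (3/2) ^ n"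
proof -
  let ?q = "cf_denom_rec (cf_coeff \<alpha>)"
  have a: "cf_coeff \<alpha> (Suc k) \<ge> 1" for k using cf_coeff_ge_1[OF assms] .
  have pos: "?q k \<ge> 1" for k using a by (rule cf_denom_rec_pos)
  have rec: "?q (Suc (Suc k)) \<ge> ?q (Suc k) + ?q k" for k
    using mult_right_mono[OF a[of "Suc k"], of "?q (Suc k)"] pos[of "Suc k"]
    by simp
  have mono: "?q k \<le> ?q (Suc k)" for k
  proof (cases k)
    case (Suc j)
    then show ?thesis using rec[of j] pos[of j] by simp
  qed (use a[of 0] in auto)
  \<comment> \<open>The base 3/2 works because (3/2)^2 is at most 3/2 + 1; the factor 2/3 fits index
    1, where the denominator may be 1.\<close>
  have "2/3 * (3/2) ^ k \<le> real_of_int (?q k) \<and> 2/3 * (3/2) ^ Suc k \<le> real_of_int (?q (Suc k))" for k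
  proof (induction k)
    case 0
    then show ?case using a[of 0] by auto
  next
    case (Suc k)
    have "real_of_int (?q (Suc (Suc k))) \<ge> real_of_int (?q (Suc k)) + real_of_int (?q k)"
      using rec[of k] by linarith
    moreover have "2/3 * (3/2::real) ^ Suc (Suc k) \<le> 2/3 * (3/2) ^ Suc k + 2/3 * (3/2) ^ k" by simp
    ultimately show ?case using Suc by (meson order_trans add_mono)
  qed
  with pos mono show "cf_denom \<alpha> n \<ge> 1" "cf_denom \<alpha> n \<le> cf_denom \<alpha> (Suc n)"
    "real_of_int (cf_denom \<alpha> n) \<ge> 2/3 * (3/2) ^ n"
    by (auto simp: cf_denom_eq[OF assms])
qed

subsection \<open>The covering by neighbourhoods of fractions\<close>

text \<open>The threshold for the iterated logarithm of the next denominator: the saved power of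
  \<open>ln x\<close> is large enough to make the Perez-Marco series converge and small enough to
  keep the gauge sums finite for every \<sigma> > 2.\<close>

definition cf_gap :: "real \<Rightarrow> real" where
  "cf_gap x = x * ln x powr (- 1/4)"

lemma summable_of_cf_gap:
  fixes Q :: "nat \<Rightarrow> real"
  assumes pos: "\<And>n. Q n \<ge> 1" and mono: "\<And>n. Q n \<le> Q (Suc n)"
    and growth: "\<And>n. Q n \<ge> 2/3 * (3/2) ^ n"
    and gap: "\<forall>\<^sub>F n in sequentially. ln (ln (Q (Suc n))) \<le> cf_gap (Q n)"
  shows "summable (\<lambda>n. ln (ln (Q (Suc n))) / Q n)"
proof -
  have lim: "filterlim Q at_top sequentially"
    by (rule filterlim_at_top_mono[of "\<lambda>n. 2/3 * (3/2) ^ n"]) (use growth in \<open>auto, real_asymp\<close>)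
  \<comment> \<open>The square root of the bound on \<open>1 / Q n\<close> that
    \<open>growth\<close> gives.\<close>
  define R where "R n = sqrt (3/2) * sqrt (2/3) ^ n" for n :: nat
  define v where "v n = ln (Q n) powr (- 1/4)" for n
  have "((\<lambda>x. ln x powr (- 1/4)) \<longlongrightarrow> 0) (at_top::real filter)" by real_asymp
  then have "v \<longlonglongrightarrow> 0" unfolding v_def by (rule filterlim_compose[OF _ lim])
  then have "summable (\<lambda>n. v n - v (Suc n))" by (rule telescope_summable')
  moreover have "summable R"
    unfolding R_def by (intro summable_mult summable_geometric) simp
  ultimately have "summable (\<lambda>n. R n + 2 * (v n - v (Suc n)))"
    by (metis summable_add summable_mult)
  moreover have "\<forall>\<^sub>F n in sequentially. norm (ln (ln (Q (Suc n))) / Q n)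
      \<le> R n + 2 * (v n - v (Suc n))"
  proof -
    \<comment> \<open>In the second case below this gives
      \<open>ln (Q (Suc n)) \<ge> 16 * ln (Q n)\<close>; the factor is 16 because its power -1/4 is
      1/2.\<close>
    have ev: "\<forall>\<^sub>F x in at_top. exp 1 < (x::real) \<and> 16 * ln x \<le> exp (sqrt x)"
      by (intro eventually_conj; real_asymp)
    show ?thesis
      using gap eventually_compose_filterlim[OF ev lim]
    proof eventually_elim
      case (elim n)
      have e: "exp 1 < Q (Suc n)" using elim mono[of n] by linarith
      have l: "1 < ln (Q n)" "ln (Q n) \<le> ln (Q (Suc n))"
        using elim mono[of n] pos[of n] ln_less_cancel_iff[of "exp 1" "Q n"] by auto
      have vmono: "v (Suc n) \<le> v n"
        unfolding v_def using l by (intro powr_mono2') auto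
      have nn: "norm (ln (ln (Q (Suc n))) / Q n) = ln (ln (Q (Suc n))) / Q n"
        using l pos[of n] by simp
      have root: "1 / sqrt (Q n) \<le> R n"
      proof -
        have "1 / Q n \<le> 3/2 * (2/3)^n"
          using growth[of n] pos[of n] by (simp add: field_simps)
        then have "sqrt (1 / Q n) \<le> sqrt (3/2 * (2/3)^n)" by simp
        then show ?thesis unfolding R_def by (simp add: real_sqrt_divide real_sqrt_mult real_sqrt_power)
      qed
      show ?case
      proof (cases "ln (ln (Q (Suc n))) \<le> sqrt (Q n)")
        case True
        then have "ln (ln (Q (Suc n))) / Q n \<le> sqrt (Q n) / Q n"
          using pos[of n] by (simp add: divide_right_mono)
        also have "\<dots> = 1 / sqrt (Q n)" using pos[of n] by (simp add: field_simps)
        also note root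
        also have "R n \<le> R n + 2 * (v n - v (Suc n))" using vmono by simp
        finally show ?thesis unfolding nn .
      next
        case False
        then have "exp (sqrt (Q n)) < ln (Q (Suc n))"
          using l by (metis exp_less_cancel_iff exp_ln le_less_trans less_le_trans not_le zero_less_one order_less_trans)
        then have "16 * ln (Q n) \<le> ln (Q (Suc n))" using elim by linarith
        then have "v (Suc n) \<le> (16 * ln (Q n)) powr (- 1/4)"
          unfolding v_def using l by (intro powr_mono2') auto
        also have "\<dots> = 16 powr (- 1/4) * v n"
          unfolding v_def using l by (simp add: powr_mult)
        also have "16 powr (- 1/4) = ((2::real) powr 4) powr (- 1/4)" by simp
        also have "\<dots> = 1/2" by (simp only: powr_powr) (simp add: powr_minus)
        finally have "v n \<le> 2 * (v n - v (Suc n))" by simp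
        \<comment> \<open>Here \<open>gap\<close> enters: its right-hand side divided by
          \<open>Q n\<close> is \<open>v n\<close>.\<close>
        moreover have "ln (ln (Q (Suc n))) / Q n \<le> v n"
          using elim pos[of n] by (simp add: divide_le_eq cf_gap_def v_def mult.commute)
        moreover have "0 \<le> R n" by (simp add: R_def)
        ultimately show ?thesis unfolding nn by linarith
      qed
    qed
  qed
  ultimately show ?thesis
    by (rule summable_comparison_test_ev[rotated])
qed

lemma gauge2_sum_bigo:
  assumes "\<sigma> > 2"
  shows "(\<lambda>n. (2 * (n * ln n powr (1/4)) + 1) * gauge2 \<sigma> (exp (- exp (cf_gap n))))
    \<in> O(\<lambda>n::nat. ln (real n) powr (-1/4) - ln (real (Suc n)) powr (-1/4))"
proof -
  have g: "gauge2 \<sigma> (exp (- exp t)) = t powr (-2) * ln t powr (-\<sigma>)" for t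
    by (simp add: gauge2_def ln_div)
  show ?thesis unfolding g cf_gap_def using assms by real_asymp
qed

lemma not_Perez_Marco_approximable:
  assumes "\<alpha> \<notin> Perez_Marco"
  shows "\<exists>\<^sub>F q in sequentially. \<exists>p::int. \<bar>\<alpha> - p / real q\<bar> < exp (- exp (cf_gap (real q)))"
  unfolding frequently_sequentially
proof
  fix N :: nat
  show "\<exists>q\<ge>N. \<exists>p::int. \<bar>\<alpha> - p / real q\<bar> < exp (- exp (cf_gap (real q)))"
  proof (cases "\<alpha> \<in> \<rat>")
    case True
    then obtain m k where k: "\<alpha> = of_int m / real k" "k \<noteq> 0"
      unfolding Rats_eq_int_div_nat by auto
    have "\<bar>\<alpha> - of_int (m * int (Suc N)) / real (k * Suc N)\<bar> = 0"
      using k by (simp del: mult_Suc_right of_nat_Suc)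
    then have "\<bar>\<alpha> - of_int (m * int (Suc N)) / real (k * Suc N)\<bar>
        < exp (- exp (cf_gap (real (k * Suc N))))"
      by (simp only: exp_gt_zero)
    moreover have "k * Suc N \<ge> N" using k by (cases k) auto
    ultimately show ?thesis by blast
  next
    case False
    note growth = cf_denom_growth[OF False]
    \<comment> \<open>The index shift matches the series in \<open>Perez_Marco\<close>, which starts
      at the denominator of index 1.\<close>
    define Q where "Q n = real_of_int (cf_denom \<alpha> (Suc n))" for n
    have Q: "Q n \<ge> 1" "Q n \<le> Q (Suc n)" "Q n \<ge> 2/3 * (3/2) ^ n" for n
      using growth(1,2)[of "Suc n"] growth(3)[of "Suc n"] zero_le_power[of "3/2::real" n]
      by (simp_all add: Q_def)
    have "\<not> summable (\<lambda>n. ln (ln (Q (Suc n))) / Q n)"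
      using assms False by (simp add: Perez_Marco_def Q_def)
    then have "\<not> (\<forall>\<^sub>F n in sequentially. ln (ln (Q (Suc n))) \<le> cf_gap (Q n))"
      using summable_of_cf_gap[of Q, OF Q] by blast
    then have "\<exists>\<^sub>F n in sequentially. \<not> ln (ln (Q (Suc n))) \<le> cf_gap (Q n)"
      by (simp add: frequently_def)
    \<comment> \<open>The bound 3 keeps the next denominator above 1, so that both logarithms can be
      inverted.\<close>
    moreover have "\<forall>\<^sub>F n in sequentially. Q n \<ge> max 3 (real N)"
    proof -
      have "filterlim Q at_top sequentially"
        by (rule filterlim_at_top_mono[of "\<lambda>n. 2/3 * (3/2) ^ n"]) (use Q in \<open>auto, real_asymp\<close>)
      then show ?thesis unfolding filterlim_at_top by blast
    qed
    ultimately obtain n where n: "\<not> ln (ln (Q (Suc n))) \<le> cf_gap (Q n)" "Q n \<ge> max 3 (real N)"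
      using frequently_eventually_frequently frequently_ex by (metis (mono_tags, lifting))
    have "Q (Suc n) > 1" using n Q(2)[of n] by simp
    then have "exp (cf_gap (Q n)) < ln (Q (Suc n))"
      using n(1) by (metis exp_less_cancel_iff exp_ln ln_gt_zero not_le)
    then have "exp (exp (cf_gap (Q n))) < Q (Suc n)"
      using \<open>Q (Suc n) > 1\<close> by (metis exp_less_cancel_iff exp_ln order.strict_trans zero_less_one)
    then have "1 / Q (Suc n) < 1 / exp (exp (cf_gap (Q n)))"
      using \<open>Q (Suc n) > 1\<close> by (intro divide_strict_left_mono) auto
    then have small: "1 / Q (Suc n) < exp (- exp (cf_gap (Q n)))"
      by (simp add: exp_minus inverse_eq_divide)
    define q where "q = nat (cf_denom \<alpha> (Suc n))"
    have "real q = Q n" using growth(1)[of "Suc n"] by (simp add: q_def Q_def)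
    moreover obtain p :: int where "\<bar>\<alpha> - p / Q n\<bar> \<le> 1 / Q (Suc n)"
      unfolding Q_def using cf_approximation[OF False] by blast
    ultimately have "\<bar>\<alpha> - p / real q\<bar> < exp (- exp (cf_gap (real q)))" "q \<ge> N"
      using small n(2) by auto
    then show ?thesis by blast
  qed
qed

lemma gauge2_nonneg: "gauge2 \<sigma> t \<ge> 0"
  by (simp add: gauge2_def)

lemma complement_Perez_Marco_small_cover:
  assumes "\<sigma> > 2" "\<epsilon> > 0" "\<delta> > 0"
  shows "\<exists>x r. (\<forall>j::nat. 0 \<le> r j \<and> r j < \<epsilon>) \<and> - Perez_Marco \<subseteq> (\<Union>j. ball (x j) (r j)) \<and>
    (\<Sum>j. ennreal (gauge2 \<sigma> (r j))) < ennreal \<delta>"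
proof -
  define \<rho> where "\<rho> q = exp (- exp (cf_gap (real q)))" for q
  define b where "b q = real q * ln (real q) powr (1/4)" for q
  define M where "M q = nat \<lfloor>b q\<rfloor>" for q
  define f where "f q = (2 * b q + 1) * gauge2 \<sigma> (\<rho> q)" for q
  have b_nonneg: "b q \<ge> 0" for q by (simp add: b_def)
  have "(\<lambda>n::nat. ln (real n) powr (-1/4)) \<longlonglongrightarrow> 0" by real_asymp
  then have tel: "summable (\<lambda>n::nat. ln (real n) powr (-1/4) - ln (real (Suc n)) powr (-1/4))"
    by (rule telescope_summable')
  have "summable (\<lambda>n. norm (ln (real (n + 2)) powr (-1/4) - ln (real (Suc (n + 2))) powr (-1/4)))"
  proof -
    have "ln (real (Suc (n + 2))) powr (-1/4) \<le> ln (real (n + 2)) powr (-1/4)" for n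
      by (intro powr_mono2') auto
    then have "norm (ln (real (n + 2)) powr (-1/4) - ln (real (Suc (n + 2))) powr (-1/4))
        = ln (real (n + 2)) powr (-1/4) - ln (real (Suc (n + 2))) powr (-1/4)" for n
      by (simp only: real_norm_def abs_of_nonneg diff_ge_0_iff_ge)
    then show ?thesis using summable_ignore_initial_segment[OF tel, of 2] by presburger
  qed
  then have "summable (\<lambda>n::nat. norm (ln (real n) powr (-1/4) - ln (real (Suc n)) powr (-1/4)))"
    by (rule summable_iff_shift[THEN iffD1])
  then have f: "summable f"
    using gauge2_sum_bigo[OF assms(1)] unfolding f_def b_def \<rho>_def
    by (rule summable_comparison_test_bigo)
  obtain N1 where N1: "\<And>n. n \<ge> N1 \<Longrightarrow> norm (\<Sum>i. f (i + n)) < \<delta>"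
    using suminf_exist_split[OF assms(3) f] by blast
  have "\<rho> \<longlonglongrightarrow> 0" unfolding \<rho>_def cf_gap_def by real_asymp
  then have "\<forall>\<^sub>F q in sequentially. \<rho> q < \<epsilon>"
    using assms(2) by (rule order_tendstoD)
  then obtain N2 where N2: "\<And>q. q \<ge> N2 \<Longrightarrow> \<rho> q < \<epsilon>"
    unfolding eventually_sequentially by blast
  define N where "N = max N1 N2"
  \<comment> \<open>For the denominator \<open>k + N\<close>, the index \<open>i\<close> runs
    through the numerators from \<open>- M (k + N)\<close> to \<open>M (k + N)\<close>; larger
    \<open>i\<close> get radius 0 in \<open>r\<close>, that is, empty balls of gauge value
    0.\<close>
  define x where "x = (\<lambda>(k, i). of_int (int i - int (M (k + N))) / real (k + N))"
  define r where "r = (\<lambda>(k, i). if i \<le> 2 * M (k + N) then \<rho> (k + N) else 0)"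
  have radius: "0 \<le> r p \<and> r p < \<epsilon>" for p
    using N2[of "fst p + N"] assms(2) by (auto simp: r_def N_def \<rho>_def split: prod.split)
  have "- Perez_Marco \<subseteq> (\<Union>p. ball (x p) (r p))"
  proof
    fix \<alpha> assume "\<alpha> \<in> - Perez_Marco"
    then have "\<exists>\<^sub>F q in sequentially. \<exists>p::int. \<bar>\<alpha> - p / real q\<bar> < \<rho> q"
      using not_Perez_Marco_approximable[of \<alpha>] by (simp add: \<rho>_def)
    \<comment> \<open>The summand 1 accounts for the distance from \<alpha> to \<open>p / q\<close>;
      the bound then yields \<open>\<bar>p\<bar> \<le> b q\<close>, so this fraction occurs among
      the centres.\<close>
    moreover have "\<forall>\<^sub>F q in sequentially. q \<ge> max N 1 \<and> \<bar>\<alpha>\<bar> + 1 \<le> ln (real q) powr (1/4)"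
    proof (intro eventually_conj)
      have "filterlim (\<lambda>q::nat. ln (real q) powr (1/4)) at_top sequentially" by real_asymp
      then show "\<forall>\<^sub>F q in sequentially. \<bar>\<alpha>\<bar> + 1 \<le> ln (real q) powr (1/4)"
        unfolding filterlim_at_top by blast
    qed (rule eventually_ge_at_top)
    ultimately obtain q p where q: "\<bar>\<alpha> - of_int p / real q\<bar> < \<rho> q" "q \<ge> max N 1"
        "\<bar>\<alpha>\<bar> + 1 \<le> ln (real q) powr (1/4)"
      using frequently_eventually_frequently frequently_ex by (smt (verit, ccfv_threshold))
    have "\<rho> q \<le> 1" by (simp add: \<rho>_def)
    then have "\<bar>of_int p / real q\<bar> \<le> ln (real q) powr (1/4)" using q by linarith
    then have "\<bar>real_of_int p\<bar> \<le> b q" using q by (simp add: b_def divide_le_eq mult.commute)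
    then have p: "\<bar>p\<bar> \<le> int (M q)" by (simp add: M_def le_floor_iff b_nonneg)
    have "\<alpha> \<in> ball (x (q - N, nat (p + int (M q)))) (r (q - N, nat (p + int (M q))))"
      using p q by (auto simp: x_def r_def dist_real_def abs_minus_commute nat_le_iff)
    then show "\<alpha> \<in> (\<Union>p. ball (x p) (r p))" by blast
  qed
  moreover have "(\<Union>p. ball (x p) (r p)) = (\<Union>j. ball (x (prod_decode j)) (r (prod_decode j)))"
  proof -
    have "(\<Union>p\<in>range prod_decode. ball (x p) (r p)) = (\<Union>j. ball (x (prod_decode j)) (r (prod_decode j)))"
      by simp
    then show ?thesis by (simp only: surj_prod_decode)
  qed
  moreover have "(\<Sum>j. ennreal (gauge2 \<sigma> (r (prod_decode j)))) < ennreal \<delta>"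
  proof -
    have inner: "(\<Sum>i. ennreal (gauge2 \<sigma> (r (k, i)))) \<le> ennreal (f (k + N))" for k
    proof -
      let ?q = "k + N"
      have "(\<Sum>i. ennreal (gauge2 \<sigma> (r (k, i)))) = (\<Sum>i\<le>2 * M ?q. ennreal (gauge2 \<sigma> (r (k, i))))"
        by (intro suminf_finite) (auto simp: r_def gauge2_def)
      also have "\<dots> = ennreal (\<Sum>i\<le>2 * M ?q. gauge2 \<sigma> (r (k, i)))"
        by (simp add: gauge2_nonneg)
      also have "(\<Sum>i\<le>2 * M ?q. gauge2 \<sigma> (r (k, i))) = real (2 * M ?q + 1) * gauge2 \<sigma> (\<rho> ?q)"
        by (simp add: r_def algebra_simps)
      also have "\<dots> \<le> f ?q"
        unfolding f_def using b_nonneg[of ?q]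
        by (intro mult_right_mono gauge2_nonneg) (simp add: M_def)
      finally show ?thesis by (simp add: ennreal_leI)
    qed
    have "(\<Sum>j. ennreal (gauge2 \<sigma> (r (prod_decode j)))) = (\<Sum>k. \<Sum>i. ennreal (gauge2 \<sigma> (r (k, i))))"
      by (intro suminf_ennreal_2dimen) simp
    also have "\<dots> \<le> (\<Sum>k. ennreal (f (k + N)))"
      by (intro suminf_le inner) auto
    also have "\<dots> = ennreal (\<Sum>k. f (k + N))"
      using summable_ignore_initial_segment[OF f] b_nonneg
      by (intro suminf_ennreal_eq summable_sums) (auto simp: f_def gauge2_nonneg)
    also have "\<dots> < ennreal \<delta>"
      using N1[of N] assms(3) by (simp add: N_def ennreal_lessI)
    finally show ?thesis .
  qed
  ultimately show ?thesis
    using radius by (intro exI[of _ "\<lambda>j. x (prod_decode j)"] exI[of _ "\<lambda>j. r (prod_decode j)"]) auto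
qed

lemma hausdorff_measure_eq_0:
  assumes "\<And>\<epsilon> \<delta>::real. \<epsilon> > 0 \<Longrightarrow> \<delta> > 0 \<Longrightarrow> \<exists>(x :: nat \<Rightarrow> 'a) r. (\<forall>j. 0 \<le> r j \<and> r j < \<epsilon>) \<and>
    E \<subseteq> (\<Union>j. ball (x j) (r j)) \<and> (\<Sum>j. ennreal (h (r j))) < ennreal \<delta>"
  shows "hausdorff_measure h (E :: 'a::euclidean_space set) = 0"
proof -
  have "hausdorff_content h E \<epsilon> = 0" if "\<epsilon> > 0" for \<epsilon>
  proof -
    have "hausdorff_content h E \<epsilon> \<le> 0 + ennreal \<delta>" if "\<delta> > 0" for \<delta>
    proof -
      from assms[OF \<open>\<epsilon> > 0\<close> that] obtain x :: "nat \<Rightarrow> 'a" and r where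
        c: "\<forall>j. 0 \<le> r j \<and> r j < \<epsilon>" "E \<subseteq> (\<Union>j. ball (x j) (r j))" "(\<Sum>j. ennreal (h (r j))) < ennreal \<delta>"
        by blast
      have "hausdorff_content h E \<epsilon> \<le> (\<Sum>j. ennreal (h (r j)))"
        unfolding hausdorff_content_def by (rule Inf_lower) (use c in blast)
      then show ?thesis using c(3) by simp
    qed
    then have "hausdorff_content h E \<epsilon> \<le> 0" by (rule ennreal_le_epsilon)
    then show ?thesis by simp
  qed
  then have "\<forall>\<^sub>F \<epsilon> in at_right 0. hausdorff_content h E \<epsilon> = 0"
    by (auto simp: eventually_at_right_less eventually_mono[OF eventually_at_right_less])
  then have "(hausdorff_content h E \<longlongrightarrow> 0) (at_right 0)"
    by (rule tendsto_eventually)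
  then show ?thesis
    unfolding hausdorff_measure_def by (intro tendsto_Lim) auto
qed

subsection \<open>Energy and capacity\<close>

text \<open>Expand \<open>0 \<le> (m - t * g)\<^sup>2 / g\<close>. Summed over the pieces of a
  cover, this takes the place of Cauchy-Schwarz for infinite sums.\<close>

lemma ennreal_weighted_am_gm:
  assumes "m \<ge> 0" "t \<ge> 0" "g \<ge> 0"
  shows "ennreal (2 * m * t) \<le> inverse (ennreal g) * (ennreal m * ennreal m) + ennreal (t\<^sup>2 * g)"
proof (cases "g = 0")
  \<comment> \<open>The inverse of 0 is infinite in \<open>ennreal\<close>, so the right side is
    infinite unless \<open>m = 0\<close>.\<close>
  case True
  then show ?thesis using assms(1) by (cases "m = 0") (auto simp: ennreal_top_mult)
next
  case False
  with assms have g: "g > 0" by simp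
  have "0 \<le> (m - t * g)\<^sup>2 / g" using g by simp
  also have "\<dots> = inverse g * (m * m) + t\<^sup>2 * g - 2 * m * t"
    using g by (simp add: field_simps power2_eq_square)
  finally have "ennreal (2 * m * t) \<le> ennreal (inverse g * (m * m) + t\<^sup>2 * g)"
    by (intro ennreal_leI) simp
  also have "\<dots> = inverse (ennreal g) * (ennreal m * ennreal m) + ennreal (t\<^sup>2 * g)"
    using g assms by (simp add: ennreal_plus ennreal_mult inverse_ennreal)
  finally show ?thesis .
qed

lemma energy_ge_of_cover:
  fixes B :: "nat \<Rightarrow> complex set"
  assumes \<mu>: "prob_space \<mu>" "sets \<mu> = sets borel" "emeasure \<mu> (- K) = 0" and K: "K \<in> sets borel"
    and B: "\<And>j. B j \<in> sets borel" "K \<subseteq> (\<Union>j. B j)"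
    and k: "\<And>j z \<xi>. z \<in> B j \<Longrightarrow> \<xi> \<in> B j \<Longrightarrow> inverse (ennreal (g j)) \<le> k z \<xi>"
    and g: "\<And>j. g j \<ge> 0" "(\<Sum>j. ennreal (g j)) \<le> ennreal \<delta>" and "\<delta> > 0"
  shows "ennreal (1 / \<delta>) \<le> energy k K \<mu>"
proof -
  interpret prob_space \<mu> by fact
  \<comment> \<open>Disjoint pieces give disjoint squares \<open>A j \<times> A j\<close> in
    \<open>K \<times> K\<close>, so at each point at most one summand of \<open>?S\<close> below is
    nonzero.\<close>
  define A where "A j = K \<inter> disjointed B j" for j
  have A [measurable]: "A j \<in> sets \<mu>" for j
  proof -
    have "range (disjointed B) \<subseteq> sets borel"
      using B(1) by (intro sets.range_disjointed_sets) auto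
    then show ?thesis using K unfolding A_def \<mu>(2) by auto
  qed
  have disj: "disjoint_family A"
    using disjoint_family_disjointed[of B] unfolding A_def disjoint_family_on_def by blast
  have A_Un: "(\<Union>j. A j) = K"
    using B(2) UN_disjointed_eq[of B] unfolding A_def by auto
  have A_sub: "A j \<subseteq> B j" for j
    using disjointed_subset[of B j] unfolding A_def by blast
  define m where "m j = measure \<mu> (A j)" for j
  have m: "emeasure \<mu> (A j) = ennreal (m j)" "m j \<ge> 0" for j
    by (auto simp: m_def emeasure_eq_measure)
  have "(\<Sum>j. ennreal (m j)) = emeasure \<mu> (\<Union>j. A j)"
    unfolding m(1)[symmetric] using disj by (intro suminf_emeasure) auto
  also have "\<dots> = 1"
  proof -
    have "emeasure \<mu> (space \<mu> - K) = 0"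
      using \<mu> sets_eq_imp_space_eq[OF \<mu>(2)] by (simp add: Compl_eq_Diff_UNIV)
    then show ?thesis
      using K \<mu>(2) sets_eq_imp_space_eq[OF \<mu>(2)] prob_compl[of K]
      by (simp add: A_Un emeasure_eq_measure)
  qed
  finally have m_sum: "(\<Sum>j. ennreal (m j)) = 1" .
  let ?S = "\<lambda>p. \<Sum>j. inverse (ennreal (g j)) * indicator (A j \<times> A j) p"
  have "(\<Sum>j. inverse (ennreal (g j)) * (ennreal (m j) * ennreal (m j))) = (\<integral>\<^sup>+p. ?S p \<partial>(\<mu> \<Otimes>\<^sub>M \<mu>))"
    by (subst nn_integral_suminf)
      (auto simp: nn_integral_cmult_indicator emeasure_pair_measure_Times m)
  also have "\<dots> \<le> energy k K \<mu>"
    unfolding energy_def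
  proof (rule nn_integral_mono)
    fix p :: "complex \<times> complex"
    show "?S p \<le> k (fst p) (snd p) * indicator (K \<times> K) p"
    proof (cases "\<exists>j. p \<in> A j \<times> A j")
      case True
      then obtain j where j: "p \<in> A j \<times> A j" by blast
      have "disjoint_family (\<lambda>j. A j \<times> A j)"
        using disj unfolding disjoint_family_on_def by blast
      then have "?S p = inverse (ennreal (g j))"
        using j by (rule suminf_cmult_indicator)
      also have "\<dots> \<le> k (fst p) (snd p)"
        using j A_sub[of j] by (intro k[of _ j]) auto
      finally show ?thesis using j A_Un by (auto simp: indicator_def)
    qed (auto simp: indicator_def)
  qed
  finally have E: "(\<Sum>j. inverse (ennreal (g j)) * (ennreal (m j) * ennreal (m j))) \<le> energy k K \<mu>" .
  \<comment> \<open>This weight maximizes \<open>2 * t - t\<^sup>2 * \<delta>\<close>, with maximum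
    \<open>t\<close>; one of the two copies of \<open>t\<close> below then cancels.\<close>
  define t where "t = 1 / \<delta>"
  have t: "t > 0" "t\<^sup>2 * \<delta> = t" using \<open>\<delta> > 0\<close> by (auto simp: t_def power2_eq_square)
  have "ennreal t + ennreal t = ennreal (2 * t) * (\<Sum>j. ennreal (m j))"
    using t by (simp add: m_sum flip: ennreal_plus)
  also have "\<dots> = (\<Sum>j. ennreal (2 * m j * t))"
  proof -
    have "ennreal (2 * m j * t) = ennreal (2 * t) * ennreal (m j)" for j
      using t m[of j] by (simp add: mult_ac flip: ennreal_mult)
    then show ?thesis by simp
  qed
  also have "\<dots> \<le> (\<Sum>j. inverse (ennreal (g j)) * (ennreal (m j) * ennreal (m j)) + ennreal (t\<^sup>2 * g j))"
    using t m g by (intro suminf_le ennreal_weighted_am_gm) auto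
  also have "\<dots> = (\<Sum>j. inverse (ennreal (g j)) * (ennreal (m j) * ennreal (m j))) + ennreal (t\<^sup>2) * (\<Sum>j. ennreal (g j))"
    by (simp add: suminf_add[symmetric] ennreal_mult g)
  also have "\<dots> \<le> energy k K \<mu> + ennreal (t\<^sup>2) * ennreal \<delta>"
    using E g(2) by (intro add_mono mult_left_mono) auto
  also have "\<dots> = ennreal t + energy k K \<mu>"
    using t \<open>\<delta> > 0\<close> by (simp add: ennreal_mult[symmetric] add.commute)
  finally show ?thesis
    by (simp add: ennreal_add_left_cancel_le t_def)
qed

text \<open>The union of the cover serves as the open superset; every probability measure on a
  compact subset of it has energy at least \<open>1 / \<delta>\<close>.\<close>

lemma outer_capacity_le_of_cover:
  fixes B :: "nat \<Rightarrow> complex set"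
  assumes "\<And>j. open (B j)" "E \<subseteq> (\<Union>j. B j)"
    and "\<And>j z \<xi>. z \<in> B j \<Longrightarrow> \<xi> \<in> B j \<Longrightarrow> inverse (ennreal (g j)) \<le> k z \<xi>"
    and "\<And>j. g j \<ge> 0" "(\<Sum>j. ennreal (g j)) \<le> ennreal \<delta>" "\<delta> > 0"
  shows "outer_capacity k E \<le> ennreal \<delta>"
proof -
  have "compact_capacity k K \<le> ennreal \<delta>" if "compact K" "K \<subseteq> (\<Union>j. B j)" for K
  proof -
    have "ennreal (1 / \<delta>) \<le> min_energy k K"
      unfolding min_energy_def using assms that
      by (intro INF_greatest)
        (auto simp: borel_open borel_closed compact_imp_closed
          intro!: energy_ge_of_cover[where B = B and g = g])
    then show ?thesis
    proof (cases "min_energy k K")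
      case (real w)
      then have "1 / \<delta> \<le> w"
        using \<open>ennreal (1 / \<delta>) \<le> min_energy k K\<close> by simp
      moreover from this have "w > 0" using \<open>\<delta> > 0\<close> by (smt (verit) divide_pos_pos)
      ultimately show ?thesis
        using real \<open>\<delta> > 0\<close>
        by (auto simp: compact_capacity_def inverse_ennreal field_simps intro!: ennreal_leI)
    qed (simp add: compact_capacity_def)
  qed
  then have "inner_capacity k (\<Union>j. B j) \<le> ennreal \<delta>"
    unfolding inner_capacity_def by (intro SUP_least) auto
  moreover have "outer_capacity k E \<le> inner_capacity k (\<Union>j. B j)"
    unfolding outer_capacity_def using assms(1,2) by (intro INF_lower) auto
  ultimately show ?thesis by (rule order_trans[rotated])
qed

text \<open>Compact subsets of \<open>E\<close> are compact subsets of each open superset. Hence an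
  upper bound for the outer capacity settles both capacities.\<close>

lemma inner_capacity_le_outer_capacity: "inner_capacity k E \<le> outer_capacity k E"
  unfolding outer_capacity_def
proof (rule INF_greatest)
  fix U assume "U \<in> {U. open U \<and> E \<subseteq> U}"
  then show "inner_capacity k E \<le> inner_capacity k U"
    unfolding inner_capacity_def by (intro SUP_subset_mono) auto
qed

section \<open>The kernel on small discs compared with the gauge\<close>

definition kernel2_profile :: "real \<Rightarrow> real \<Rightarrow> real" where
  "kernel2_profile \<sigma> s = (ln (ln (exp 1 + 1 / s)))\<^sup>2 * ln (ln (ln (exp 3 + 1 / s))) powr \<sigma>"

text \<open>The summands \<open>exp 1\<close> and \<open>exp 3\<close> keep the iterated logarithms
  nonnegative at every distance, using \<open>exp 1 \<le> 3\<close> for the triple one, so square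
  and power are monotone.\<close>

lemma kernel2_profile_antimono:
  assumes "\<sigma> \<ge> 0" "0 < s" "s \<le> s'"
  shows "kernel2_profile \<sigma> s' \<le> kernel2_profile \<sigma> s"
proof -
  have i: "0 \<le> 1 / s'" "1 / s' \<le> 1 / s" using assms by (auto simp: frac_le)
  then have "ln (exp 1) \<le> ln (exp 1 + 1 / s')" "ln (exp 3) \<le> ln (exp 3 + 1 / s')"
    by (intro ln_mono; simp add: add_pos_nonneg)+
  then have 1: "1 \<le> ln (exp 1 + 1 / s')" and 3: "3 \<le> ln (exp 3 + 1 / s')" by auto
  have "ln (exp 1) \<le> ln (ln (exp 3 + 1 / s'))"
    using 3 exp_le by (intro ln_mono) auto
  then have 2: "1 \<le> ln (ln (exp 3 + 1 / s'))" by simp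
  have "ln (exp 1 + 1 / s') \<le> ln (exp 1 + 1 / s)" "ln (exp 3 + 1 / s') \<le> ln (exp 3 + 1 / s)"
    using i by (intro ln_mono; simp add: add_pos_nonneg)+
  then have 4: "ln (ln (exp 1 + 1 / s')) \<le> ln (ln (exp 1 + 1 / s))"
    "ln (ln (ln (exp 3 + 1 / s'))) \<le> ln (ln (ln (exp 3 + 1 / s)))"
    using 1 2 3 by (auto intro!: ln_mono)
  have "0 \<le> ln (ln (exp 1 + 1 / s'))" "0 \<le> ln (ln (ln (exp 3 + 1 / s')))" using 1 2 by auto
  then show ?thesis
    unfolding kernel2_profile_def using 4 assms(1)
    by (intro mult_mono power_mono powr_mono2) auto
qed

text \<open>Iterated logarithms do not feel the factor 2 in \<open>2 * r\<close>, so kernel times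
  gauge tends to 1 and eventually exceeds 1/2. Two points of a ball of radius \<open>r\<close> are
  at distance below \<open>2 * r\<close>.\<close>

lemma kernel2_ge_inverse_gauge2:
  assumes "\<sigma> > 2"
  shows "\<exists>r\<^sub>0>0. \<forall>r. 0 < r \<and> r < r\<^sub>0 \<longrightarrow>
    (\<forall>z \<xi>. dist z \<xi> < 2 * r \<longrightarrow> inverse (ennreal (2 * gauge2 \<sigma> r)) \<le> kernel2 \<sigma> z \<xi>)"
proof -
  have "((\<lambda>r. kernel2_profile \<sigma> (2 * r) * (ln (ln (1 / r)) powr (- 2) * ln (ln (ln (1 / r))) powr (- \<sigma>)))
      \<longlongrightarrow> 1) (at_right 0)"
    unfolding kernel2_profile_def using assms by real_asymp
  then have "\<forall>\<^sub>F r in at_right 0. 1 / 2 <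
      kernel2_profile \<sigma> (2 * r) * (ln (ln (1 / r)) powr (- 2) * ln (ln (ln (1 / r))) powr (- \<sigma>))"
    by (rule order_tendstoD) simp
  then obtain r\<^sub>0 where r\<^sub>0: "r\<^sub>0 > 0" "\<And>r. 0 < r \<Longrightarrow> r < r\<^sub>0 \<Longrightarrow> 1 / 2 < kernel2_profile \<sigma> (2 * r) * gauge2 \<sigma> r"
    unfolding eventually_at_right_field gauge2_def by auto
  have "inverse (ennreal (2 * gauge2 \<sigma> r)) \<le> kernel2 \<sigma> z \<xi>"
    if r: "0 < r" "r < r\<^sub>0" and d: "dist z \<xi> < 2 * r" for r z \<xi>
  proof (cases "z = \<xi>")
    case False
    have g: "1 / 2 < kernel2_profile \<sigma> (2 * r) * gauge2 \<sigma> r" using r r\<^sub>0 by blast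
    moreover have "gauge2 \<sigma> r \<ge> 0" by (simp add: gauge2_def)
    ultimately have pos: "gauge2 \<sigma> r > 0" by (cases "gauge2 \<sigma> r = 0") auto
    have "inverse (2 * gauge2 \<sigma> r) \<le> kernel2_profile \<sigma> (2 * r)"
      using g pos by (simp add: field_simps)
    also have "\<dots> \<le> kernel2_profile \<sigma> (cmod (z - \<xi>))"
      using assms False d by (intro kernel2_profile_antimono) (auto simp: dist_norm)
    finally show ?thesis
      using False pos by (simp add: kernel2_def kernel2_profile_def inverse_ennreal ennreal_leI)
  qed (simp add: kernel2_def)
  with r\<^sub>0(1) show ?thesis by blast
qed

theorem theorem1p4:
  fixes \<sigma> :: real
  assumes "\<sigma> > 2"
  shows "has_capacity (kernel2 \<sigma>) (complex_of_real ` (- Perez_Marco)) 0 \<and>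
         hausdorff_measure (gauge2 \<sigma>) (- Perez_Marco) = 0"
proof
  let ?E = "complex_of_real ` (- Perez_Marco)"
  obtain r\<^sub>0 where r\<^sub>0: "r\<^sub>0 > 0" and kernel: "\<And>r z \<xi>. 0 < r \<Longrightarrow> r < r\<^sub>0 \<Longrightarrow> dist z \<xi> < 2 * r \<Longrightarrow>
      inverse (ennreal (2 * gauge2 \<sigma> r)) \<le> kernel2 \<sigma> z \<xi>"
    using kernel2_ge_inverse_gauge2[OF assms] by blast
  have "outer_capacity (kernel2 \<sigma>) ?E \<le> 0 + ennreal \<delta>" if "\<delta> > 0" for \<delta>
  proof -
    \<comment> \<open>Halving absorbs the factor 2 before the gauge, and the scale
      \<open>r\<^sub>0\<close> puts every radius in the range of \<open>kernel\<close>.\<close>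
    have "\<delta> / 2 > 0" using that by simp
    from complement_Perez_Marco_small_cover[OF assms r\<^sub>0 this] obtain x r where
      r: "\<And>j::nat. 0 \<le> r j" "\<And>j. r j < r\<^sub>0" and cover: "- Perez_Marco \<subseteq> (\<Union>j. ball (x j) (r j))"
      and sum: "(\<Sum>j. ennreal (gauge2 \<sigma> (r j))) < ennreal (\<delta> / 2)"
      by blast
    let ?B = "\<lambda>j. ball (complex_of_real (x j)) (r j)"
    have "outer_capacity (kernel2 \<sigma>) ?E \<le> ennreal \<delta>"
    proof (rule outer_capacity_le_of_cover[where B = ?B and g = "\<lambda>j. 2 * gauge2 \<sigma> (r j)"])
      show "?E \<subseteq> (\<Union>j. ?B j)"
        using cover by (fastforce simp: dist_of_real)
      show "inverse (ennreal (2 * gauge2 \<sigma> (r j))) \<le> kernel2 \<sigma> z \<xi>" if "z \<in> ?B j" "\<xi> \<in> ?B j" for j z \<xi>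
      proof (rule kernel)
        \<comment> \<open>The padding balls of radius 0 are empty, so a ball containing
          \<open>z\<close> has positive radius.\<close>
        show "0 < r j" using that(1) r(1)[of j] by (cases "r j = 0") auto
        show "dist z \<xi> < 2 * r j"
          using that dist_triangle3[of z \<xi> "complex_of_real (x j)"] by simp
      qed (rule r(2))
      have "(\<Sum>j. ennreal (2 * gauge2 \<sigma> (r j))) = 2 * (\<Sum>j. ennreal (gauge2 \<sigma> (r j)))"
        by (simp add: ennreal_mult gauge2_nonneg)
      also have "\<dots> \<le> 2 * ennreal (\<delta> / 2)"
        using sum by (intro mult_left_mono) auto
      also have "\<dots> = ennreal (2 * (\<delta> / 2))"
        using \<open>\<delta> > 0\<close> by (subst ennreal_mult) auto
      finally show "(\<Sum>j. ennreal (2 * gauge2 \<sigma> (r j))) \<le> ennreal \<delta>" by simp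
    qed (use that gauge2_nonneg in auto)
    then show ?thesis by simp
  qed
  then have "outer_capacity (kernel2 \<sigma>) ?E \<le> 0" by (rule ennreal_le_epsilon)
  with inner_capacity_le_outer_capacity[of "kernel2 \<sigma>" ?E]
  show "has_capacity (kernel2 \<sigma>) ?E 0"
    unfolding has_capacity_def by (metis le_zero_eq order_trans)
  show "hausdorff_measure (gauge2 \<sigma>) (- Perez_Marco) = 0"
    by (rule hausdorff_measure_eq_0) (rule complement_Perez_Marco_small_cover[OF assms])
qed

end
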